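(* Let $(Y,\|\cdot\|)$ be a Banach space and $K\subseteq Y$ a closed, convex and pointed cone with nonempty interior. Take $r\in\operatorname{int}(K)$ and consider the functional $\Psi_r(y)=\inf\{t\in\mathbb{R}: tr\in y+K\}$, $y\in Y$. Furthermore, assume that either $Y$ is reflexive, or that $K$ is normal. Then there exists a norm $\|\cdot\|'$ on $Y$ such that $\|\cdot\|'$ is equivalent to $\|\cdot\|$ and $\Psi_{\|\cdot\|'}=\Psi_r$, where $\Psi_{\|\cdot\|'}$ is the Hiriart-Urruty functional of $K$ with respect to $\|\cdot\|'$.
   Context: Spaces are real. A cone is a set $C$ with $tx\in C$ for all $x\in C$, $t\ge 0$; it is pointed if $C\cap(-C)=\{0\}$. The cone $K$ is normal if there is a neighborhood base $\{V_\alpha\}_{\alpha\in T}$ of $0$ in $Y$ such that $V_\alpha=(V_\alpha+K)\cap(V_\alpha-K)$ for all $\alpha\in T$. For a norm $\|\cdot\|'$ on $Y$ equivalent to $\|\cdot\|$, the Hiriart-Urruty functional is $\Psi_{\|\cdot\|'}(y):=d(y,-K)-d(y,Y\setminus(-K))$, where $d(y,A)=\inf_{a\in A}\|y-a\|'$ is the distance from $y$ to $A$ with respect to $\|\cdot\|'$. *)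

theory Defs
  imports "HOL-Analysis.Analysis" "HOL-Library.Extended_Real"
begin

definition pointed_cone :: "'a::real_vector set \<Rightarrow> bool" where
  "pointed_cone K \<longleftrightarrow> cone K \<and> K \<inter> uminus ` K = {0}"

text \<open>The sumset and difference set are written as set comprehensions because the operator \<open>-\<close> on
  sets is set difference. A neighborhood is a set with \<open>0\<close> in its interior; it need not be open.\<close>

definition normal_cone :: "'a::real_normed_vector set \<Rightarrow> bool" where
  "normal_cone K \<longleftrightarrow>
     (\<exists>\<V>. (\<forall>V\<in>\<V>. 0 \<in> interior V) \<and>
          (\<forall>U. 0 \<in> interior U \<longrightarrow> (\<exists>V\<in>\<V>. V \<subseteq> U)) \<and>
          (\<forall>V\<in>\<V>. V = {v + k |v k. v \<in> V \<and> k \<in> K} \<inter> {v - k |v k. v \<in> V \<and> k \<in> K}))"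

lift_definition bidual_embedding ::
  "'a::real_normed_vector \<Rightarrow> ('a \<Rightarrow>\<^sub>L real) \<Rightarrow>\<^sub>L real" is "\<lambda>x f. blinfun_apply f x"
  by (rule blinfun.bounded_linear_left)

definition reflexive_space :: "'a::real_normed_vector itself \<Rightarrow> bool" where
  "reflexive_space _ \<longleftrightarrow> surj (bidual_embedding :: 'a \<Rightarrow> ('a \<Rightarrow>\<^sub>L real) \<Rightarrow>\<^sub>L real)"

definition is_norm :: "('a::real_vector \<Rightarrow> real) \<Rightarrow> bool" where
  "is_norm N \<longleftrightarrow>
     (\<forall>x. 0 \<le> N x) \<and>
     (\<forall>x. N x = 0 \<longleftrightarrow> x = 0) \<and>
     (\<forall>a x. N (a *\<^sub>R x) = \<bar>a\<bar> * N x) \<and>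
     (\<forall>x y. N (x + y) \<le> N x + N y)"

definition equivalent_norms :: "('a \<Rightarrow> real) \<Rightarrow> ('a \<Rightarrow> real) \<Rightarrow> bool" where
  "equivalent_norms N M \<longleftrightarrow> (\<exists>c>0. \<exists>C>0. \<forall>x. c * M x \<le> N x \<and> N x \<le> C * M x)"

text \<open>Infima are taken in the extended reals, so that the infimum of the empty set is \<open>\<infinity>\<close> and that of
  a set unbounded below is \<open>-\<infinity>\<close>. Under the hypotheses of the theorem these values arise only when
  the space is \<open>{0}\<close>. In \<open>hiriart_urruty\<close> the first distance is finite whenever \<open>K\<close> is nonempty, so
  \<open>\<infinity> - \<infinity>\<close> does not occur.\<close>

definition dist_to :: "('a::real_vector \<Rightarrow> real) \<Rightarrow> 'a \<Rightarrow> 'a set \<Rightarrow> ereal" where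
  "dist_to N y A = (INF a\<in>A. ereal (N (y - a)))"

definition hiriart_urruty :: "('a::real_vector \<Rightarrow> real) \<Rightarrow> 'a set \<Rightarrow> 'a \<Rightarrow> ereal" where
  "hiriart_urruty N K y = dist_to N y (uminus ` K) - dist_to N y (UNIV - uminus ` K)"

definition Psi :: "'a::real_vector set \<Rightarrow> 'a \<Rightarrow> 'a \<Rightarrow> ereal" where
  "Psi K r y = (INF t \<in> {t::real. t *\<^sub>R r \<in> (+) y ` K}. ereal t)"

end

theory Submission
  imports Defs
begin

text \<open>Write \<open>p\<close> for the real-valued version of \<open>\<Psi>\<^sub>r\<close>; it is sublinear and
  \<open>-K = {p \<le> 0}\<close>. If a norm \<open>N\<close> satisfies \<open>p \<le> N\<close> and \<open>N r = 1\<close>, then \<open>p\<close> is 1-Lipschitz for \<open>N\<close>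
  and moves at unit speed along \<open>r\<close>, so the distances from \<open>y\<close> to \<open>-K\<close> and to its complement are
  the positive and negative parts of \<open>p y\<close>. The norm \<open>max (p x) (p (-x)) (\<parallel>x\<parallel> / \<parallel>r\<parallel>)\<close> has both properties.
  It is equivalent to the original norm because \<open>p\<close> is bounded on the unit ball
  and the last term bounds it from below.\<close>

section \<open>The cone as an order with unit \<open>r\<close>, and its gauge-like
  functional\<close>

locale interior_unit_cone =
  fixes K :: "'a::real_normed_vector set" and r :: 'a
  assumes closed_K: "closed K" and convex_K: "convex K" and pointed_K: "pointed_cone K"
    and r_interior: "r \<in> interior K" and r_nonzero: "r \<noteq> 0"
begin

text \<open>The real \<open>Inf\<close> is meaningful only for a nonempty set that is bounded below;
  both facts are established inside \<open>p_le_iff\<close>.\<close>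

definition p :: "'a \<Rightarrow> real" where
  "p x = Inf {t. t *\<^sub>R r - x \<in> K}"

lemma K_scaleR: "x \<in> K \<Longrightarrow> 0 \<le> c \<Longrightarrow> c *\<^sub>R x \<in> K"
  using pointed_K by (auto simp: pointed_cone_def cone_def)

lemma K_add:
  assumes "x \<in> K" "y \<in> K"
  shows "x + y \<in> K"
proof -
  have "(1/2) *\<^sub>R x + (1/2) *\<^sub>R y \<in> K"
    using convexD[OF convex_K assms, of "1/2" "1/2"] by simp
  then have "2 *\<^sub>R ((1/2) *\<^sub>R x + (1/2) *\<^sub>R y) \<in> K"
    by (rule K_scaleR) simp
  then show ?thesis
    by (simp add: scaleR_add_right)
qed

text \<open>A negative multiple of \<open>r\<close> in \<open>K\<close> could be rescaled to
  \<open>- r\<close>, against pointedness and \<open>r\<close> being nonzero.\<close>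

lemma scaleR_r_in_K_iff: "t *\<^sub>R r \<in> K \<longleftrightarrow> 0 \<le> t"
proof
  have rK: "r \<in> K"
    using r_interior interior_subset by blast
  show "t *\<^sub>R r \<in> K" if "0 \<le> t"
    using K_scaleR[OF rK that] .
  show "0 \<le> t" if "t *\<^sub>R r \<in> K"
  proof (rule ccontr)
    assume "\<not> 0 \<le> t"
    then have "(1 / - t) *\<^sub>R (t *\<^sub>R r) \<in> K"
      using K_scaleR[OF that, of "1 / - t"] by simp
    then have "- r \<in> K"
      using \<open>\<not> 0 \<le> t\<close> by simp
    then have "r \<in> K \<inter> uminus ` K"
      using rK by (force simp: image_iff)
    then show False
      using pointed_K r_nonzero by (auto simp: pointed_cone_def)
  qed
qed

text \<open>Interior points are order units: if the closed ball of radius \<open>e\<close> about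
  \<open>r\<close> lies in \<open>K\<close>, then moving \<open>r\<close> by a vector of norm
  exactly \<open>e\<close> in the direction of \<open>- x\<close> stays in \<open>K\<close>, and
  rescaling gives the claim with \<open>C = inverse e\<close>.\<close>

lemma norm_bound:
  obtains C where "0 < C" "\<And>x. (C * norm x) *\<^sub>R r - x \<in> K"
proof -
  obtain e where e: "e > 0" "cball r e \<subseteq> K"
    using r_interior mem_interior_cball by blast
  have "(inverse e * norm x) *\<^sub>R r - x \<in> K" for x
  proof (cases "x = 0")
    case True
    then show ?thesis
      using scaleR_r_in_K_iff[of 0] by simp
  next
    case False
    define s where "s = inverse e * norm x"
    have s: "s > 0"
      using False e by (simp add: s_def)
    have "r - inverse s *\<^sub>R x \<in> cball r e"
      using False e by (simp add: dist_norm s_def)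
    then have "s *\<^sub>R (r - inverse s *\<^sub>R x) \<in> K"
      using e s by (intro K_scaleR) auto
    then show ?thesis
      using s by (simp add: scaleR_diff_right s_def[symmetric])
  qed
  then show thesis
    using e that[of "inverse e"] by simp
qed

text \<open>The infimum is attained because \<open>K\<close> is closed, and the set of admissible
  \<open>t\<close> is upward closed because \<open>r\<close> is in \<open>K\<close>. All later facts
  about \<open>p\<close> reduce to membership in \<open>K\<close> through this equivalence.\<close>

lemma p_le_iff: "p x \<le> t \<longleftrightarrow> t *\<^sub>R r - x \<in> K"
proof -
  let ?S = "{t. t *\<^sub>R r - x \<in> K}"
  obtain C where C: "\<And>x. (C * norm x) *\<^sub>R r - x \<in> K"
    using norm_bound by blast
  have ne: "?S \<noteq> {}"
    using C[of x] by blast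
  have "- (C * norm x) \<le> t" if "t \<in> ?S" for t
  proof -
    \<comment> \<open>Adding the order-unit bound for \<open>- x\<close> cancels \<open>x\<close>
      and leaves a multiple of \<open>r\<close>, whose coefficient must be nonnegative.\<close>
    have "(t *\<^sub>R r - x) + ((C * norm (- x)) *\<^sub>R r - - x) \<in> K"
      using that by (intro K_add C) simp
    then have "(t + C * norm x) *\<^sub>R r \<in> K"
      by (simp add: scaleR_add_left)
    then show ?thesis
      using scaleR_r_in_K_iff by fastforce
  qed
  then have bdd: "bdd_below ?S"
    by (rule bdd_belowI)
  have "closed ((\<lambda>t. t *\<^sub>R r - x) -` K)"
    by (intro closed_vimage closed_K continuous_intros)
  then have "closed ?S"
    by (simp add: vimage_def)
  then have p_mem: "p x \<in> ?S"
    unfolding p_def using closed_contains_Inf[OF ne bdd] by blast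
  have "t *\<^sub>R r - x \<in> K" if "p x \<le> t"
  proof -
    have "(p x *\<^sub>R r - x) + (t - p x) *\<^sub>R r \<in> K"
      using p_mem that by (intro K_add) (auto simp: scaleR_r_in_K_iff)
    then show ?thesis
      by (simp add: scaleR_diff_left)
  qed
  moreover have "p x \<le> t" if "t *\<^sub>R r - x \<in> K"
    unfolding p_def using that bdd by (intro cInf_lower) auto
  ultimately show ?thesis
    by blast
qed

lemma p_in_K: "p x *\<^sub>R r - x \<in> K"
  using p_le_iff[of x "p x"] by simp

lemma uminus_K_iff: "x \<in> uminus ` K \<longleftrightarrow> p x \<le> 0"
  by (force simp: p_le_iff image_iff)

lemma p_scaleR_r: "p (c *\<^sub>R r) = c"
proof -
  have "p (c *\<^sub>R r) \<le> t \<longleftrightarrow> c \<le> t" for t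
    using scaleR_r_in_K_iff[of "t - c"] by (simp add: p_le_iff scaleR_diff_left)
  then show ?thesis
    by (metis order_antisym order_refl)
qed

lemma p_add: "p (x + y) \<le> p x + p y"
  using K_add[OF p_in_K[of x] p_in_K[of y]]
  by (simp add: p_le_iff scaleR_add_left algebra_simps)

lemma p_scaleR_le: "0 \<le> c \<Longrightarrow> p (c *\<^sub>R x) \<le> c * p x"
  using K_scaleR[OF p_in_K[of x]] by (simp add: p_le_iff scaleR_diff_right)

lemma p_scaleR:
  assumes "0 \<le> c"
  shows "p (c *\<^sub>R x) = c * p x"
proof (cases "c = 0")
  case True
  then show ?thesis
    using p_scaleR_r[of 0] by simp
next
  case False
  \<comment> \<open>Scaling back by \<open>inverse c\<close> turns the one-sided bound into its
    converse.\<close>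
  with assms have "p x \<le> inverse c * p (c *\<^sub>R x)"
    using p_scaleR_le[of "inverse c" "c *\<^sub>R x"] by simp
  then have "c * p x \<le> p (c *\<^sub>R x)"
    using False assms by (simp add: field_simps)
  then show ?thesis
    using p_scaleR_le[OF assms, of x] by simp
qed

text \<open>Subadditivity is used twice, adding \<open>c *\<^sub>R r\<close> and then removing it;
  it is sharp here because \<open>p\<close> is linear on the line through \<open>r\<close>.\<close>

lemma p_add_scaleR_r: "p (x + c *\<^sub>R r) = p x + c"
proof (rule antisym)
  show "p (x + c *\<^sub>R r) \<le> p x + c"
    using p_add[of x "c *\<^sub>R r"] by (simp add: p_scaleR_r)
  have "p x \<le> p (x + c *\<^sub>R r) + p ((- c) *\<^sub>R r)"
    using p_add[of "x + c *\<^sub>R r" "(- c) *\<^sub>R r"] by simp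
  then show "p x + c \<le> p (x + c *\<^sub>R r)"
    unfolding p_scaleR_r by simp
qed

section \<open>Comparison of \<open>p\<close> with \<open>Psi\<close> and the Hiriart-Urruty
  functional\<close>

lemma Psi_eq_p: "Psi K r y = ereal (p y)"
proof -
  have "{t. t *\<^sub>R r \<in> (+) y ` K} = {p y..}"
    by (force simp: p_le_iff image_iff algebra_simps)
  then show ?thesis
    unfolding Psi_def by (auto intro!: antisym INF_lower INF_greatest)
qed

text \<open>The complement of \<open>-K\<close> is open, so the infimum defining the distance to it is only approached,
  by moving from \<open>y\<close> slightly further than \<open>- p y\<close> along \<open>r\<close>.\<close>

lemma hiriart_urruty_eq_Psi:
  assumes norm: "is_norm N" and p_le: "\<And>x. p x \<le> N x" and N_r: "N r = 1"
  shows "hiriart_urruty N K = Psi K r"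
proof
  fix y
  have N: "0 \<le> N x" "N (c *\<^sub>R x) = \<bar>c\<bar> * N x" for x c
    using norm by (auto simp: is_norm_def)
  have N_minus: "N (- x) = N x" for x
    using N(2)[of "-1" x] by simp
  have N_scaleR_r: "N (c *\<^sub>R r) = \<bar>c\<bar>" for c
    by (simp add: N N_r)
  have Lipschitz: "p x \<le> p z + N (x - z)" for x z
    using p_add[of z "x - z"] p_le[of "x - z"] by simp
  have d_in: "dist_to N y (uminus ` K) = ereal (max 0 (p y))"
  proof (rule antisym)
    let ?c = "max 0 (p y)"
    \<comment> \<open>Moving back along \<open>r\<close> by the positive part of \<open>p y\<close>
      reaches a nearest point of \<open>-K\<close>.\<close>
    have "y + (- ?c) *\<^sub>R r \<in> uminus ` K"
      unfolding uminus_K_iff p_add_scaleR_r by simp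
    then have "dist_to N y (uminus ` K) \<le> ereal (N (y - (y + (- ?c) *\<^sub>R r)))"
      unfolding dist_to_def by (rule INF_lower)
    also have "N (y - (y + (- ?c) *\<^sub>R r)) = ?c"
      by (simp add: N_scaleR_r)
    finally show "dist_to N y (uminus ` K) \<le> ereal ?c" .
    show "ereal ?c \<le> dist_to N y (uminus ` K)"
      unfolding dist_to_def
    proof (rule INF_greatest)
      fix a assume "a \<in> uminus ` K"
      then show "ereal ?c \<le> ereal (N (y - a))"
        using Lipschitz[of y a] N(1)[of "y - a"] by (simp add: uminus_K_iff)
    qed
  qed
  have d_out: "dist_to N y (UNIV - uminus ` K) = ereal (max 0 (- p y))"
  proof (rule antisym)
    let ?c = "max 0 (- p y)"
    show "dist_to N y (UNIV - uminus ` K) \<le> ereal ?c"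
    proof (rule ereal_le_epsilon2)
      fix e :: real assume "0 < e"
      then have "y + (?c + e) *\<^sub>R r \<in> UNIV - uminus ` K"
        unfolding Diff_iff uminus_K_iff p_add_scaleR_r by simp
      then have "dist_to N y (UNIV - uminus ` K) \<le> ereal (N (y - (y + (?c + e) *\<^sub>R r)))"
        unfolding dist_to_def by (rule INF_lower)
      also have "N (y - (y + (?c + e) *\<^sub>R r)) = ?c + e"
        using \<open>0 < e\<close> by (simp add: N_minus N_scaleR_r)
      finally show "dist_to N y (UNIV - uminus ` K) \<le> ereal ?c + ereal e"
        unfolding plus_ereal.simps .
    qed
    show "ereal ?c \<le> dist_to N y (UNIV - uminus ` K)"
      unfolding dist_to_def
    proof (rule INF_greatest)
      fix a assume "a \<in> UNIV - uminus ` K"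
      then show "ereal ?c \<le> ereal (N (y - a))"
        using Lipschitz[of a y] N(1)[of "y - a"] N_minus[of "y - a"]
        by (simp add: uminus_K_iff)
    qed
  qed
  show "hiriart_urruty N K y = Psi K r y"
    by (simp add: hiriart_urruty_def d_in d_out Psi_eq_p max_def)
qed

section \<open>The equivalent norm\<close>

definition cone_norm :: "'a \<Rightarrow> real" where
  "cone_norm x = Max {p x, p (- x), norm x / norm r}"

lemma cone_norm_le_iff:
  "cone_norm x \<le> c \<longleftrightarrow> p x \<le> c \<and> p (- x) \<le> c \<and> norm x / norm r \<le> c"
  by (simp add: cone_norm_def)

lemma cone_norm_ge: "p x \<le> cone_norm x" "p (- x) \<le> cone_norm x" "norm x / norm r \<le> cone_norm x"
  by (simp_all add: cone_norm_def)

text \<open>All three entries are sublinear, the pair \<open>p x\<close>, \<open>p (- x)\<close>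
  restores symmetry, and the third entry gives nonnegativity and definiteness.\<close>

lemma is_norm_cone_norm: "is_norm cone_norm"
proof -
  have zero: "cone_norm 0 = 0"
    using p_scaleR_r[of 0] by (simp add: cone_norm_def)
  have nonneg: "0 \<le> cone_norm x" for x
    using cone_norm_ge(3)[of x] by (meson divide_nonneg_nonneg norm_ge_zero order_trans)
  have definite: "x = 0" if "cone_norm x = 0" for x
  proof -
    have "norm x / norm r \<le> 0"
      using cone_norm_ge(3)[of x] that by simp
    then show ?thesis
      using r_nonzero by (simp add: divide_le_0_iff)
  qed
  have minus: "cone_norm (- x) = cone_norm x" for x
    by (simp add: cone_norm_def insert_commute)
  have scaleR_le: "cone_norm (a *\<^sub>R x) \<le> a * cone_norm x" if "0 \<le> a" for a x
    using that cone_norm_ge[of x, THEN mult_left_mono, OF that] p_scaleR[OF that, of "- x"]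
    by (simp add: cone_norm_le_iff p_scaleR)
  have scaleR_pos: "cone_norm (a *\<^sub>R x) = a * cone_norm x" if "0 < a" for a x
    using scaleR_le[of a x] scaleR_le[of "inverse a" "a *\<^sub>R x"] that by (simp add: field_simps)
  have scaleR: "cone_norm (a *\<^sub>R x) = \<bar>a\<bar> * cone_norm x" for a x
    using scaleR_pos[of a x] scaleR_pos[of "- a" x] minus[of "a *\<^sub>R x"] zero
    by (cases a "0::real" rule: linorder_cases) auto
  have triangle: "cone_norm (x + y) \<le> cone_norm x + cone_norm y" for x y
  proof -
    have "norm (x + y) / norm r \<le> norm x / norm r + norm y / norm r"
      using divide_right_mono[OF norm_triangle_ineq norm_ge_zero, of x y r]
      by (simp add: add_divide_distrib)
    then show ?thesis
      using p_add[of x y] p_add[of "- x" "- y"] cone_norm_ge[of x] cone_norm_ge[of y]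
      by (simp add: cone_norm_le_iff)
  qed
  show ?thesis
    unfolding is_norm_def using zero nonneg definite scaleR triangle by blast
qed

lemma equivalent_norms_cone_norm: "equivalent_norms cone_norm norm"
proof -
  obtain C where C: "0 < C" "\<And>x. p x \<le> C * norm x"
    using norm_bound by (metis p_le_iff)
  define D where "D = max C (inverse (norm r))"
  have "cone_norm x \<le> D * norm x" for x
  proof -
    have "C * norm x \<le> D * norm x" "inverse (norm r) * norm x \<le> D * norm x"
      unfolding D_def by (intro mult_right_mono; simp)+
    then show ?thesis
      using C(2)[of x] C(2)[of "- x"] by (simp add: cone_norm_le_iff divide_inverse mult.commute)
  qed
  moreover have "inverse (norm r) * norm x \<le> cone_norm x" for x
    using cone_norm_ge(3)[of x] by (simp add: divide_inverse mult.commute)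
  moreover have "0 < inverse (norm r)" "0 < D"
    using r_nonzero C(1) by (auto simp: D_def)
  ultimately show ?thesis
    unfolding equivalent_norms_def by blast
qed

text \<open>At \<open>r\<close> the entries are 1, -1 and 1; dividing by \<open>norm r\<close>
  serves this normalization.\<close>

lemma cone_norm_r: "cone_norm r = 1"
  using p_scaleR_r[of 1] p_scaleR_r[of "-1"] r_nonzero by (simp add: cone_norm_def)

end

section \<open>The degenerate case \<open>r = 0\<close> and the conclusion\<close>

lemma pointed_cone_UNIV_trivial:
  assumes "pointed_cone (UNIV :: 'a::real_vector set)"
  shows "(x :: 'a) = 0"
proof -
  have "x \<in> UNIV \<inter> uminus ` UNIV"
    by simp
  then show ?thesis
    using assms by (auto simp: pointed_cone_def)
qed

text \<open>A ball around 0 meets every ray, and the cone contains each ray that it meets away from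
  0.\<close>

lemma cone_interior_zero_UNIV:
  fixes K :: "'a::real_normed_vector set"
  assumes "cone K" "0 \<in> interior K"
  shows "K = UNIV"
proof -
  obtain e where e: "e > 0" "cball 0 e \<subseteq> K"
    using assms mem_interior_cball by blast
  have "x \<in> K" for x
  proof (cases "x = 0")
    case False
    then have "(e / norm x) *\<^sub>R x \<in> K"
      using e by auto
    then have "(norm x / e) *\<^sub>R ((e / norm x) *\<^sub>R x) \<in> K"
      using assms(1) e(1) by (simp add: cone_def del: scaleR_scaleR)
    then show ?thesis
      using e(1) False by simp
  qed (use e in auto)
  then show ?thesis
    by blast
qed

theorem theorem4p10:
  fixes K :: "'a::banach set" and r :: 'a
  assumes "closed K" and "convex K" and "pointed_cone K" and "interior K \<noteq> {}"
    and "r \<in> interior K"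
    and "reflexive_space TYPE('a) \<or> normal_cone K"
  shows "\<exists>N :: 'a \<Rightarrow> real. is_norm N \<and> equivalent_norms N norm \<and>
           hiriart_urruty N K = Psi K r"
proof (cases "r = 0")
  case True
  \<comment> \<open>The space is \<open>{0}\<close> and both functionals take the value \<open>-\<infinity>\<close>.\<close>
  then have K: "K = UNIV"
    using assms by (intro cone_interior_zero_UNIV) (auto simp: pointed_cone_def)
  then have trivial: "x = 0" for x :: 'a
    using assms(3) pointed_cone_UNIV_trivial by blast
  have UNIV_eq: "(UNIV :: 'a set) = {0}"
    using trivial by blast
  have "is_norm (norm :: 'a \<Rightarrow> real)"
    by (auto simp: is_norm_def norm_triangle_ineq)
  moreover have "equivalent_norms (norm :: 'a \<Rightarrow> real) norm"
    unfolding equivalent_norms_def by (auto intro!: exI[of _ 1])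
  moreover have "hiriart_urruty norm K = Psi K r"
  proof
    fix y :: 'a
    have "y = 0"
      by (rule trivial)
    \<comment> \<open>With \<open>r = 0\<close> every real \<open>t\<close> is admissible in
      \<open>Psi\<close>. On the other side the complement of \<open>-K\<close> is empty, so its
      distance is \<infinity> and is subtracted from 0.\<close>
    have "(INF t. ereal t) = - \<infinity>"
      by (intro ereal_bot INF_lower) simp
    then show "hiriart_urruty norm K y = Psi K r y"
      by (simp add: hiriart_urruty_def Psi_def dist_to_def K UNIV_eq \<open>y = 0\<close> \<open>r = 0\<close> top_ereal_def)
  qed
  ultimately show ?thesis
    by blast
next
  case False
  then interpret interior_unit_cone K r
    using assms by unfold_locales auto
  show ?thesis
    using is_norm_cone_norm equivalent_norms_cone_norm
      hiriart_urruty_eq_Psi[OF is_norm_cone_norm cone_norm_ge(1) cone_norm_r] by blast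
qed

end
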